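(* Let $\beta>1$ be an algebraic number and let $\beta'$ be a conjugate of $\beta$ with $|\beta'|<1$. For $z\in\mathbb{Q}(\beta)$ let $z'$ denote the image of $z$ under the field isomorphism $\mathbb{Q}(\beta)\to\mathbb{Q}(\beta')$ sending $\beta\mapsto\beta'$. Put $H:=\sup\{|z'|\mid z\in\mathbb{Z}_{-\beta}\}$ and $K:=\inf\{|z'|\mid z\in\mathbb{Z}_{-\beta}\setminus(-\beta)\mathbb{Z}_{-\beta}\}$. If $K>0$, then $$\frac1{|\beta'|^{L_\oplus(-\beta)}}\le\frac{2H}{K}\qquad\text{and}\qquad\frac1{|\beta'|^{L_\otimes(-\beta)}}\le\frac{H^2}{K}.$$ Moreover, if the supremum defining $H$ or the infimum defining $K$ is not attained, then both inequalities are strict.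
   Context: For $\beta>1$, let $I_\beta=\big[\frac{-\beta}{\beta+1},\frac1{\beta+1}\big)$ and $T_{-\beta}:I_\beta\to I_\beta$, $T_{-\beta}(x)=-\beta x-\lfloor -\beta x+\frac{\beta}{\beta+1}\rfloor$. For $y\in I_\beta$ put $y_i=\lfloor -\beta T_{-\beta}^{i-1}(y)+\frac{\beta}{\beta+1}\rfloor$ ($i\ge1$) and $d_{-\beta}(y)=y_1y_2y_3\cdots$. The $(-\beta)$-expansion of a real $x$: take the minimal non-negative integer $j$ with $y=x(-\beta)^{-j}\in\big(\frac{-\beta}{\beta+1},\frac1{\beta+1}\big)$, compute $d_{-\beta}(y)=y_1y_2\cdots$; the expansion is $x=\sum_{i\ge1}y_i(-\beta)^{j-i}$ with digit $y_i$ the coefficient of $(-\beta)^{j-i}$. $\mathrm{Fin}(-\beta)$ is the set of reals whose $(-\beta)$-expansion has finitely many non-zero digits, and $\mathbb{Z}_{-\beta}$ is the set of reals whose $(-\beta)$-expansion has no non-zero digit at negative powers of $(-\beta)$ (these are integer polynomial expressions in $\beta$, hence lie in $\mathbb{Q}(\beta)$). Define $L_\oplus(-\beta)=\min\{l\in\mathbb{N}\mid \forall x,y\in\mathbb{Z}_{-\beta}:\ x+y\in\mathrm{Fin}(-\beta)\Rightarrow x+y\in(-\beta)^{-l}\mathbb{Z}_{-\beta}\}$ and $L_\otimes(-\beta)=\min\{l\in\mathbb{N}\mid \forall x,y\in\mathbb{Z}_{-\beta}:\ xy\in\mathrm{Fin}(-\beta)\Rightarrow xy\in(-\beta)^{-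l}\mathbb{Z}_{-\beta}\}$.
   Formalization: The set ℤ_{-β} \ (-β)ℤ_{-β} is assumed nonempty; it is empty exactly when β < (1+√5)/2, where ℤ_{-β} = {0}, so K is an infimum over the empty set and the claim is undefined or (with K = +∞) false. *)

theory Defs
  imports Complex_Main "HOL-Computational_Algebra.Computational_Algebra"
begin

definition T_neg :: "real \<Rightarrow> real \<Rightarrow> real" where
  "T_neg \<beta> x = - \<beta> * x - of_int \<lfloor>- \<beta> * x + \<beta> / (\<beta> + 1)\<rfloor>"

(* Digits are indexed from i = 1; T_neg is meant on [-\<beta>/(\<beta>+1), 1/(\<beta>+1)), which it maps to itself. *)
definition d_neg :: "real \<Rightarrow> real \<Rightarrow> nat \<Rightarrow> int" where
  "d_neg \<beta> y i = \<lfloor>- \<beta> * (T_neg \<beta> ^^ (i - 1)) y + \<beta> / (\<beta> + 1)\<rfloor>"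

(* The interval is open at both ends, although T_neg also acts on its left endpoint. *)
definition expansion_exponent :: "real \<Rightarrow> real \<Rightarrow> nat" where
  "expansion_exponent \<beta> x =
     (LEAST j. x / (- \<beta>) ^ j \<in> {- \<beta> / (\<beta> + 1) <..< 1 / (\<beta> + 1)})"

(* The coefficient of (-\<beta>)^k in the expansion of x, for an arbitrary integer k. *)
definition expansion_digit :: "real \<Rightarrow> real \<Rightarrow> int \<Rightarrow> int" where
  "expansion_digit \<beta> x k =
     (let j = expansion_exponent \<beta> x
      in if k < int j then d_neg \<beta> (x / (- \<beta>) ^ j) (nat (int j - k)) else 0)"

definition Fin_neg :: "real \<Rightarrow> real set" where
  "Fin_neg \<beta> = {x. finite {k. expansion_digit \<beta> x k \<noteq> 0}}"

definition Z_neg :: "real \<Rightarrow> real set" where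
  "Z_neg \<beta> = {x. \<forall>k<0. expansion_digit \<beta> x k = 0}"

definition L_plus_set :: "real \<Rightarrow> nat set" where
  "L_plus_set \<beta> = {l. \<forall>x\<in>Z_neg \<beta>. \<forall>y\<in>Z_neg \<beta>.
     x + y \<in> Fin_neg \<beta> \<longrightarrow> x + y \<in> (\<lambda>z. z / (- \<beta>) ^ l) ` Z_neg \<beta>}"

definition L_times_set :: "real \<Rightarrow> nat set" where
  "L_times_set \<beta> = {l. \<forall>x\<in>Z_neg \<beta>. \<forall>y\<in>Z_neg \<beta>.
     x * y \<in> Fin_neg \<beta> \<longrightarrow> x * y \<in> (\<lambda>z. z / (- \<beta>) ^ l) ` Z_neg \<beta>}"

(* The minima are meaningful only when the respective sets are nonempty. *)
definition L_plus :: "real \<Rightarrow> nat" where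
  "L_plus \<beta> = (LEAST l. l \<in> L_plus_set \<beta>)"

definition L_times :: "real \<Rightarrow> nat" where
  "L_times \<beta> = (LEAST l. l \<in> L_times_set \<beta>)"

(* Closure under inverse is harmless at 0, since inverse 0 = 0. *)
definition is_subfield :: "'a::field set \<Rightarrow> bool" where
  "is_subfield F \<longleftrightarrow> 0 \<in> F \<and> 1 \<in> F \<and>
     (\<forall>x\<in>F. \<forall>y\<in>F. x + y \<in> F \<and> x * y \<in> F) \<and> (\<forall>x\<in>F. - x \<in> F \<and> inverse x \<in> F)"

(* In characteristic 0 every subfield contains the rationals, so this is Q(a). *)
definition rat_adjoin :: "'a::field_char_0 \<Rightarrow> 'a set" where
  "rat_adjoin a = \<Inter>{F. is_subfield F \<and> a \<in> F}"

definition field_iso_on :: "('a::field \<Rightarrow> 'b::field) \<Rightarrow> 'a set \<Rightarrow> 'b set \<Rightarrow> bool" where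
  "field_iso_on \<sigma> F G \<longleftrightarrow> bij_betw \<sigma> F G \<and> \<sigma> 1 = 1 \<and>
     (\<forall>x\<in>F. \<forall>y\<in>F. \<sigma> (x + y) = \<sigma> x + \<sigma> y \<and> \<sigma> (x * y) = \<sigma> x * \<sigma> y)"

definition is_min_poly :: "rat poly \<Rightarrow> 'a::field_char_0 \<Rightarrow> bool" where
  "is_min_poly p x \<longleftrightarrow> lead_coeff p = 1 \<and> irreducible p \<and> poly (map_poly of_rat p) x = 0"

definition is_conjugate :: "real \<Rightarrow> complex \<Rightarrow> bool" where
  "is_conjugate \<beta> \<beta>' \<longleftrightarrow> (\<exists>p. is_min_poly p \<beta> \<and> poly (map_poly of_rat p) \<beta>' = 0)"

end

theory Submission
  imports Defs
begin

text \<open>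
  If \<open>l \<ge> 1\<close> is minimal with \<open>w = (-\<beta>)\<^sup>l u \<in> \<int>\<^bsub>-\<beta>\<^esub>\<close>, then \<open>w \<notin> (-\<beta>) \<int>\<^bsub>-\<beta>\<^esub>\<close>, so
  \<open>K \<le> |w'| = |\<beta>'|\<^sup>l |u'|\<close>, while \<open>|u'| \<le> 2H\<close> for a sum and \<open>|u'| \<le> H\<^sup>2\<close> for a product
  of two \<open>(-\<beta>)\<close>-integers. The case \<open>l = 0\<close> needs \<open>K \<le> H\<^sup>2\<close>, which follows from \<open>K \<le> H\<close> and
  \<open>1 \<in> \<int>\<^bsub>-\<beta>\<^esub>\<close>; the latter holds unless \<open>\<int>\<^bsub>-\<beta>\<^esub> = {0}\<close>.
\<close>

section \<open>The transformation and its digits\<close>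

text \<open>The interval is half-open of length 1, so subtracting the floor reduces any real modulo
  1 into it.\<close>

lemma T_neg_mem:
  assumes "\<beta> > 1"
  shows "T_neg \<beta> x \<in> {- \<beta> / (\<beta> + 1) ..< 1 / (\<beta> + 1)}"
proof -
  have c: "\<beta> / (\<beta> + 1) + 1 / (\<beta> + 1) = 1"
    using assms by (simp add: field_simps)
  show ?thesis
    unfolding T_neg_def atLeastLessThan_iff minus_divide_left [symmetric]
    using c floor_correct [of "- \<beta> * x + \<beta> / (\<beta> + 1)"] by linarith
qed

lemma T_neg_funpow_mem:
  assumes "\<beta> > 1" and "y \<in> {- \<beta> / (\<beta> + 1) ..< 1 / (\<beta> + 1)}"
  shows "(T_neg \<beta> ^^ n) y \<in> {- \<beta> / (\<beta> + 1) ..< 1 / (\<beta> + 1)}"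
  using assms(2) T_neg_mem [OF assms(1)] by (cases n) simp_all

lemma T_neg_funpow_Suc:
  "(T_neg \<beta> ^^ Suc n) y = - \<beta> * (T_neg \<beta> ^^ n) y - of_int (d_neg \<beta> y (Suc n))"
  by (simp add: T_neg_def d_neg_def)

text \<open>At \<open>i = 0\<close> truncated subtraction would make \<open>d_neg\<close> return the
  first digit again, and the shift would fail.\<close>

lemma d_neg_Suc: "i \<ge> 1 \<Longrightarrow> d_neg \<beta> y (Suc i) = d_neg \<beta> (T_neg \<beta> y) i"
  by (cases i) (simp_all add: d_neg_def funpow_swap1)

text \<open>The argument of the floor decreases in the iterate, from \<beta> at the left endpoint to
  0 at the right one.\<close>

lemma d_neg_bounds:
  assumes "\<beta> > 1" and "y \<in> {- \<beta> / (\<beta> + 1) ..< 1 / (\<beta> + 1)}"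
  shows "0 \<le> d_neg \<beta> y i" and "of_int (d_neg \<beta> y i) \<le> \<beta>"
proof -
  define u where "u = (T_neg \<beta> ^^ (i - 1)) y"
  have "u \<in> {- \<beta> / (\<beta> + 1) ..< 1 / (\<beta> + 1)}"
    unfolding u_def by (rule T_neg_funpow_mem [OF assms])
  then have lo: "- \<beta> / (\<beta> + 1) \<le> u" and hi: "u < 1 / (\<beta> + 1)" by auto
  have "\<beta> * u \<le> \<beta> * (1 / (\<beta> + 1))" "\<beta> * (- \<beta> / (\<beta> + 1)) \<le> \<beta> * u"
    using lo hi assms(1) by (intro mult_left_mono; simp)+
  moreover have "- (\<beta> * (- \<beta> / (\<beta> + 1))) + \<beta> / (\<beta> + 1) = (\<beta> * \<beta> + \<beta>) / (\<beta> + 1)"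
    by (simp add: add_divide_distrib)
  moreover have "\<beta> * (1 / (\<beta> + 1)) = \<beta> / (\<beta> + 1)" and "(\<beta> * \<beta> + \<beta>) / (\<beta> + 1) = \<beta>"
    using assms(1) by (simp_all add: field_simps)
  ultimately have "0 \<le> - \<beta> * u + \<beta> / (\<beta> + 1)" and ub: "- \<beta> * u + \<beta> / (\<beta> + 1) \<le> \<beta>"
    by auto
  then show "0 \<le> d_neg \<beta> y i" by (simp add: d_neg_def u_def)
  show "of_int (d_neg \<beta> y i) \<le> \<beta>"
    using ub of_int_floor_le [of "- \<beta> * u + \<beta> / (\<beta> + 1)"]
    unfolding d_neg_def u_def [symmetric] by linarith
qed

text \<open>The point 0 is fixed with digit 0. Conversely, while digits vanish the map is
  multiplication by -\<beta>, which would drive a nonzero iterate out of the interval.\<close>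

lemma T_neg_funpow_eq_0_iff:
  assumes "\<beta> > 1" and "y \<in> {- \<beta> / (\<beta> + 1) ..< 1 / (\<beta> + 1)}"
  shows "(T_neg \<beta> ^^ n) y = 0 \<longleftrightarrow> (\<forall>i>n. d_neg \<beta> y i = 0)"
proof
  assume 0: "(T_neg \<beta> ^^ n) y = 0"
  have T0: "T_neg \<beta> 0 = 0"
    using assms(1) by (simp add: T_neg_def floor_eq_iff field_simps)
  have "(T_neg \<beta> ^^ (m + n)) y = 0" for m
    by (induction m) (simp_all add: 0 T0)
  then have z: "(T_neg \<beta> ^^ m) y = 0" if "m \<ge> n" for m
    using that le_Suc_ex by (metis add.commute)
  show "\<forall>i>n. d_neg \<beta> y i = 0"
  proof (intro allI impI)
    fix i assume "n < i"
    then have "(T_neg \<beta> ^^ (i - 1)) y = 0" by (intro z) auto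
    then show "d_neg \<beta> y i = 0"
      using assms(1) by (simp add: d_neg_def floor_eq_iff field_simps)
  qed
next
  assume d: "\<forall>i>n. d_neg \<beta> y i = 0"
  define u where "u = (T_neg \<beta> ^^ n) y"
  have pow: "(T_neg \<beta> ^^ (n + m)) y = (- \<beta>) ^ m * u" for m
  proof (induction m)
    case (Suc m)
    then show ?case using d T_neg_funpow_Suc [where \<beta> = \<beta> and n = "n + m" and y = y] by simp
  qed (simp add: u_def)
  show "(T_neg \<beta> ^^ n) y = 0"
  proof (rule ccontr)
    assume "(T_neg \<beta> ^^ n) y \<noteq> 0"
    then have "\<bar>u\<bar> > 0" by (simp add: u_def)
    \<comment> \<open>This power pushes the iterate beyond absolute value 1, while the interval lies
      in [-1, 1].\<close>
    obtain m where m: "1 / \<bar>u\<bar> < \<beta> ^ m"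
      using real_arch_pow [OF assms(1)] by blast
    have "\<bar>(- \<beta>) ^ m * u\<bar> > 1"
      using m \<open>\<bar>u\<bar> > 0\<close> assms(1) by (simp add: abs_mult power_abs field_simps)
    moreover have "(- \<beta>) ^ m * u \<in> {- \<beta> / (\<beta> + 1) ..< 1 / (\<beta> + 1)}"
      using T_neg_funpow_mem [OF assms, of "n + m"] pow by simp
    moreover have "- 1 \<le> - \<beta> / (\<beta> + 1)" "1 / (\<beta> + 1) \<le> 1"
      using assms(1) by (simp_all add: field_simps)
    ultimately show False unfolding atLeastLessThan_iff by linarith
  qed
qed

text \<open>Horner's scheme: each step multiplies by -\<beta> and splits off a new digit as constant
  term.\<close>

lemma power_mult_eq_digit_sum:
  assumes "\<beta> > 1" and "y \<in> {- \<beta> / (\<beta> + 1) ..< 1 / (\<beta> + 1)}"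
  shows "\<exists>a :: nat \<Rightarrow> int. (\<forall>k. 0 \<le> a k \<and> of_int (a k) \<le> \<beta>) \<and>
    (- \<beta>) ^ n * y = (\<Sum>k<n. of_int (a k) * (- \<beta>) ^ k) + (T_neg \<beta> ^^ n) y"
proof (induction n)
  case 0
  then show ?case using assms(1) by (auto intro!: exI [of _ "\<lambda>_. 0"])
next
  case (Suc n)
  then obtain a :: "nat \<Rightarrow> int" where a: "\<And>k. 0 \<le> a k \<and> of_int (a k) \<le> \<beta>"
    and eq: "(- \<beta>) ^ n * y = (\<Sum>k<n. of_int (a k) * (- \<beta>) ^ k) + (T_neg \<beta> ^^ n) y"
    by blast
  \<comment> \<open>The new digit enters at position 0 and the old coefficients move up by
    one.\<close>
  define b where "b = case_nat (d_neg \<beta> y (Suc n)) a"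
  have "0 \<le> b k \<and> of_int (b k) \<le> \<beta>" for k
    using a d_neg_bounds [OF assms] by (cases k) (simp_all add: b_def)
  moreover have "(- \<beta>) ^ Suc n * y = (\<Sum>k<Suc n. of_int (b k) * (- \<beta>) ^ k) + (T_neg \<beta> ^^ Suc n) y"
  proof -
    have "(- \<beta>) ^ Suc n * y = - \<beta> * ((- \<beta>) ^ n * y)" by simp
    also have "\<dots> = (\<Sum>k<n. of_int (a k) * (- \<beta>) ^ Suc k) + - \<beta> * (T_neg \<beta> ^^ n) y"
      unfolding eq distrib_left sum_distrib_left by (simp add: mult_ac)
    also have "\<dots> = (\<Sum>k<Suc n. of_int (b k) * (- \<beta>) ^ k) + (T_neg \<beta> ^^ Suc n) y"
      unfolding sum.lessThan_Suc_shift T_neg_funpow_Suc by (simp add: b_def)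
    finally show ?thesis .
  qed
  ultimately show ?case by blast
qed

section \<open>Expansions and multiplication by the base\<close>

lemma expansion_exponent_exists:
  fixes \<beta> x :: real
  assumes "\<beta> > 1"
  shows "\<exists>j. x / (- \<beta>) ^ j \<in> {- \<beta> / (\<beta> + 1) <..< 1 / (\<beta> + 1)}"
proof -
  \<comment> \<open>Chosen to bring the quotient within 1/(\<beta>+1) of 0; since \<beta> > 1, the
    interval contains that symmetric neighbourhood.\<close>
  obtain m where m: "\<bar>x\<bar> * (\<beta> + 1) < \<beta> ^ m"
    using real_arch_pow [OF assms] by blast
  have "\<bar>x / (- \<beta>) ^ m\<bar> < 1 / (\<beta> + 1)"
    using m assms by (simp add: power_abs field_simps)
  moreover have "- \<beta> / (\<beta> + 1) < - (1 / (\<beta> + 1))"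
    using assms by (simp add: field_simps)
  ultimately show ?thesis by (intro exI [of _ m]) (simp only: greaterThanLessThan_iff; linarith)
qed

lemma expansion_exponent_mem:
  assumes "\<beta> > 1"
  shows "x / (- \<beta>) ^ expansion_exponent \<beta> x \<in> {- \<beta> / (\<beta> + 1) <..< 1 / (\<beta> + 1)}"
  unfolding expansion_exponent_def by (rule LeastI_ex [OF expansion_exponent_exists [OF assms]])

lemma expansion_exponent_le:
  "x / (- \<beta>) ^ j \<in> {- \<beta> / (\<beta> + 1) <..< 1 / (\<beta> + 1)} \<Longrightarrow> expansion_exponent \<beta> x \<le> j"
  unfolding expansion_exponent_def by (rule Least_le)

lemma expansion_exponent_mult_base:
  assumes "\<beta> > 1" and "- \<beta> * x \<notin> {- \<beta> / (\<beta> + 1) <..< 1 / (\<beta> + 1)}"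
  shows "expansion_exponent \<beta> (- \<beta> * x) = Suc (expansion_exponent \<beta> x)"
proof (rule antisym)
  show "expansion_exponent \<beta> (- \<beta> * x) \<le> Suc (expansion_exponent \<beta> x)"
    using expansion_exponent_mem [OF assms(1), of x] assms(1)
    by (intro expansion_exponent_le) simp
  \<comment> \<open>Exponent 0 is impossible because the product lies outside the interval; its
    predecessor is then admissible for \<open>x\<close>.\<close>
  obtain j where j: "expansion_exponent \<beta> (- \<beta> * x) = Suc j"
    using assms expansion_exponent_mem [OF assms(1), of "- \<beta> * x"]
    by (cases "expansion_exponent \<beta> (- \<beta> * x)") auto
  have "expansion_exponent \<beta> x \<le> j"
    using expansion_exponent_mem [OF assms(1), of "- \<beta> * x"] assms(1)
    unfolding j by (intro expansion_exponent_le) simp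
  then show "Suc (expansion_exponent \<beta> x) \<le> expansion_exponent \<beta> (- \<beta> * x)"
    unfolding j by simp
qed

lemma expansion_exponent_eq_0:
  "x \<in> {- \<beta> / (\<beta> + 1) <..< 1 / (\<beta> + 1)} \<Longrightarrow> expansion_exponent \<beta> x = 0"
  using expansion_exponent_le [of x \<beta> 0] by simp

text \<open>If -\<beta>x is in the interval, so is \<open>x\<close>; both exponents are 0, and
  \<open>x\<close> has first digit 0 followed by the digits of -\<beta>x. Otherwise the exponent
  grows by one and the normalised point stays the same.\<close>

lemma expansion_digit_mult_base:
  assumes "\<beta> > 1"
  shows "expansion_digit \<beta> (- \<beta> * x) k = expansion_digit \<beta> x (k - 1)"
proof (cases "- \<beta> * x \<in> {- \<beta> / (\<beta> + 1) <..< 1 / (\<beta> + 1)}")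
  case True
  \<comment> \<open>With this \<open>c\<close> the interval is (-\<beta>c, c), and the endpoint
    estimates become linear.\<close>
  define c where "c = 1 / (\<beta> + 1)"
  have c: "\<beta> / (\<beta> + 1) = \<beta> * c" "0 < c" "c + \<beta> * c = 1"
    using assms by (simp_all add: c_def field_simps)
  have bx: "- (\<beta> * x) < c" "\<beta> * x < \<beta> * c"
    using True
    unfolding greaterThanLessThan_iff minus_divide_left [symmetric] c(1) c_def [symmetric]
    by simp_all
  have "x < c" using bx(2) assms by simp
  have "- x < c"
  proof (cases "x \<ge> 0")
    case False
    then have "- x \<le> \<beta> * - x" using assms by (simp add: mult_le_cancel_right1)
    then show ?thesis using bx by simp
  qed (use c(2) in auto)
  have "c < \<beta> * c" using assms c(2) by simp
  have x: "x \<in> {- \<beta> / (\<beta> + 1) <..< 1 / (\<beta> + 1)}"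
    using \<open>x < c\<close> \<open>- x < c\<close> \<open>c < \<beta> * c\<close>
    unfolding greaterThanLessThan_iff minus_divide_left [symmetric] c(1) c_def [symmetric]
    by linarith
  \<comment> \<open>The argument is positive since \<beta>x < \<beta>c, and below c + \<beta>c = 1
    since -\<beta>x < c.\<close>
  have "\<lfloor>- \<beta> * x + \<beta> / (\<beta> + 1)\<rfloor> = 0"
    unfolding floor_eq_iff c(1) using bx c by auto
  then have d1: "d_neg \<beta> x 1 = 0" and T: "T_neg \<beta> x = - \<beta> * x"
    by (simp_all add: d_neg_def T_neg_def)
  show ?thesis
  proof (cases "k < 0")
    case True
    then have "nat (1 - k) = Suc (nat (- k))" by simp
    with True show ?thesis
      using expansion_exponent_eq_0 [OF x] expansion_exponent_eq_0 [OF \<open>- \<beta> * x \<in> _\<close>]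
        d_neg_Suc [of "nat (- k)" \<beta> x] T
      by (simp add: expansion_digit_def)
  next
    case False
    \<comment> \<open>At \<open>k = 0\<close> the right side reads the first digit of
      \<open>x\<close>, which is 0; for larger \<open>k\<close> both sides take the default
      0.\<close>
    then show ?thesis
      using expansion_exponent_eq_0 [OF x] expansion_exponent_eq_0 [OF \<open>- \<beta> * x \<in> _\<close>] d1
      by (cases "k = 0") (simp_all add: expansion_digit_def)
  qed
next
  case False
  have "- \<beta> * x / (- \<beta>) ^ Suc j = x / (- \<beta>) ^ j" for j
    using assms by simp
  then show ?thesis
    unfolding expansion_digit_def Let_def expansion_exponent_mult_base [OF assms False]
    by (auto intro!: arg_cong [where f = "d_neg _ _"])
qed

lemma expansion_digit_mult_base_power:
  assumes "\<beta> > 1"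
  shows "expansion_digit \<beta> ((- \<beta>) ^ n * x) k = expansion_digit \<beta> x (k - int n)"
proof (induction n arbitrary: k)
  case (Suc n)
  have "expansion_digit \<beta> ((- \<beta>) ^ Suc n * x) k = expansion_digit \<beta> (- \<beta> * ((- \<beta>) ^ n * x)) k"
    by (simp add: mult.assoc)
  also have "\<dots> = expansion_digit \<beta> x (k - 1 - int n)"
    by (simp only: expansion_digit_mult_base [OF assms] Suc)
  finally show ?case by (simp add: algebra_simps)
qed simp

section \<open>The sets of integers and of finite expansions\<close>

lemma Z_neg_mult_base_power:
  assumes "\<beta> > 1" and "x \<in> Z_neg \<beta>"
  shows "(- \<beta>) ^ n * x \<in> Z_neg \<beta>"
  using assms by (simp add: Z_neg_def expansion_digit_mult_base_power)

text \<open>Finitely many nonzero digits have a lower bound \<open>b\<close> on their positions;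
  shifting by -b, when positive, clears the fractional part.\<close>

lemma Fin_neg_imp_mult_base_power_mem_Z_neg:
  assumes "\<beta> > 1" and "x \<in> Fin_neg \<beta>"
  shows "\<exists>n. (- \<beta>) ^ n * x \<in> Z_neg \<beta>"
proof -
  have "finite {k. expansion_digit \<beta> x k \<noteq> 0}" using assms(2) by (simp add: Fin_neg_def)
  then obtain b where b: "\<And>k. expansion_digit \<beta> x k \<noteq> 0 \<Longrightarrow> b \<le> k"
    by (metis (mono_tags, lifting) bdd_below.E bdd_below_finite mem_Collect_eq)
  have "(- \<beta>) ^ nat (- b) * x \<in> Z_neg \<beta>"
    using b by (fastforce simp: Z_neg_def expansion_digit_mult_base_power [OF assms(1)])
  then show ?thesis ..
qed

text \<open>Any \<open>n\<close> that brings \<open>x\<close> into the open interval may serve as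
  certificate, minimal or not, because digits shift with powers of the base.\<close>

lemma Z_neg_iff:
  assumes "\<beta> > 1"
  shows "x \<in> Z_neg \<beta> \<longleftrightarrow> (\<exists>n y. y \<in> {- \<beta> / (\<beta> + 1) <..< 1 / (\<beta> + 1)} \<and>
    x = (- \<beta>) ^ n * y \<and> (T_neg \<beta> ^^ n) y = 0)"
proof
  assume x: "x \<in> Z_neg \<beta>"
  define j where "j = expansion_exponent \<beta> x"
  define y where "y = x / (- \<beta>) ^ j"
  have y: "y \<in> {- \<beta> / (\<beta> + 1) <..< 1 / (\<beta> + 1)}"
    unfolding y_def j_def by (rule expansion_exponent_mem [OF assms])
  have "d_neg \<beta> y i = 0" if "i > j" for i
  proof -
    have "expansion_digit \<beta> x (int j - int i) = 0"
      using x that by (simp add: Z_neg_def)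
    then show ?thesis using that
      by (simp add: expansion_digit_def Let_def flip: j_def y_def split: if_splits)
  qed
  then have "(T_neg \<beta> ^^ j) y = 0"
    using T_neg_funpow_eq_0_iff [OF assms, of y j] y by auto
  moreover have "x = (- \<beta>) ^ j * y" using assms by (simp add: y_def)
  ultimately show "\<exists>n y. y \<in> {- \<beta> / (\<beta> + 1) <..< 1 / (\<beta> + 1)} \<and>
    x = (- \<beta>) ^ n * y \<and> (T_neg \<beta> ^^ n) y = 0" using y by blast
next
  assume "\<exists>n y. y \<in> {- \<beta> / (\<beta> + 1) <..< 1 / (\<beta> + 1)} \<and>
    x = (- \<beta>) ^ n * y \<and> (T_neg \<beta> ^^ n) y = 0"
  then obtain n y where y: "y \<in> {- \<beta> / (\<beta> + 1) <..< 1 / (\<beta> + 1)}"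
    and x: "x = (- \<beta>) ^ n * y" and T: "(T_neg \<beta> ^^ n) y = 0" by blast
  have d: "d_neg \<beta> y i = 0" if "i > n" for i
    using T_neg_funpow_eq_0_iff [OF assms, of y n] y T that by auto
  have "expansion_digit \<beta> x k = 0" if "k < 0" for k
    unfolding x expansion_digit_mult_base_power [OF assms]
    using that expansion_exponent_eq_0 [OF y] by (simp add: expansion_digit_def d)
  then show "x \<in> Z_neg \<beta>" by (simp add: Z_neg_def)
qed

lemma Z_neg_digit_sum:
  assumes "\<beta> > 1" and "x \<in> Z_neg \<beta>"
  shows "\<exists>n (a :: nat \<Rightarrow> int). (\<forall>k. 0 \<le> a k \<and> of_int (a k) \<le> \<beta>) \<and>
    x = (\<Sum>k<n. of_int (a k) * (- \<beta>) ^ k)"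
proof -
  obtain n y where "y \<in> {- \<beta> / (\<beta> + 1) <..< 1 / (\<beta> + 1)}"
    and "x = (- \<beta>) ^ n * y" and "(T_neg \<beta> ^^ n) y = 0"
    using assms Z_neg_iff by blast
  then show ?thesis using power_mult_eq_digit_sum [OF assms(1), of y n] by auto
qed

text \<open>The condition on \<beta> says that -1/\<beta> is not below the left endpoint. Off
  equality it lies in the open interval, and one step sends it to 0.\<close>

lemma one_mem_Z_neg:
  assumes "\<beta> > 1" and "\<beta> + 1 \<le> \<beta>\<^sup>2"
  shows "1 \<in> Z_neg \<beta>"
proof (cases "\<beta> + 1 = \<beta>\<^sup>2")
  case False
  have "T_neg \<beta> (- 1 / \<beta>) = 0"
    using assms(1) by (simp add: T_neg_def floor_eq_iff field_simps)
  moreover have "- 1 / \<beta> \<in> {- \<beta> / (\<beta> + 1) <..< 1 / (\<beta> + 1)}"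
    using assms False by (simp add: field_simps power2_eq_square)
  ultimately show ?thesis
    using assms(1) by (subst Z_neg_iff) (auto intro!: exI [of _ "1::nat"] exI [of _ "- 1 / \<beta>"])
next
  case True
  \<comment> \<open>For the golden ratio \<open>-1/\<beta>\<close> is the excluded left endpoint, and \<open>1\<close> expands as \<open>\<beta>\<^sup>2 - \<beta>\<close>.\<close>
  have sq: "\<beta> * \<beta> = \<beta> + 1" using True by (simp add: power2_eq_square)
  \<comment> \<open>The interval is now (-g, g^2), and the witness -g^3 has orbit -g^3, -g, 0,
    0.\<close>
  define g where "g = 1 / \<beta>"
  have bg: "\<beta> * g = 1" using assms(1) by (simp add: g_def)
  have g: "g = \<beta> - 1" using sq assms(1) by (simp add: g_def field_simps)
  have c: "\<beta> / (\<beta> + 1) = g" "1 / (\<beta> + 1) = g * g"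
    using assms(1) sq by (simp_all add: g_def field_simps)
  have g0: "0 < g" "g < 1" using assms(1) by (simp_all add: g_def)
  have gg: "g * g = 1 - g" using bg by (simp add: g algebra_simps)
  have T1: "T_neg \<beta> (- (g * g * g)) = - g"
  proof -
    have "- \<beta> * - (g * g * g) = 1 - g" by (simp add: bg gg flip: mult.assoc)
    then show ?thesis unfolding T_neg_def c by simp
  qed
  have T2: "T_neg \<beta> (- g) = 0"
    using g0 bg by (simp add: T_neg_def c floor_eq_iff)
  have T3: "T_neg \<beta> 0 = 0"
    using g0 by (simp add: T_neg_def c floor_eq_iff)
  \<comment> \<open>Rewriting the cube linearly in \<open>g\<close> lets linear arithmetic place
    -g^3 above -g.\<close>
  have ggg: "g * g * g = g - (1 - g)" by (simp add: gg left_diff_distrib)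
  have "(T_neg \<beta> ^^ 3) (- (g * g * g)) = 0"
    by (simp add: numeral_3_eq_3 T1 T2 T3)
  moreover have "- (g * g * g) \<in> {- \<beta> / (\<beta> + 1) <..< 1 / (\<beta> + 1)}"
  proof -
    have "0 < g * g * g" "0 < g * g" using g0 by simp_all
    then show ?thesis
      unfolding greaterThanLessThan_iff minus_divide_left [symmetric] c
      using g0 ggg by linarith
  qed
  moreover have "1 = (- \<beta>) ^ 3 * - (g * g * g)"
    using assms(1) by (simp add: g_def power3_eq_cube)
  ultimately show ?thesis
    unfolding Z_neg_iff [OF assms(1)]
    by (intro exI [of _ 3] exI [of _ "- (g * g * g)"] conjI)
qed

text \<open>At the last nonzero iterate \<open>u\<close> of the orbit, \<open>-\<beta> u\<close> is a positive integer digit, and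
  \<open>u\<close> cannot lie below the left endpoint of the interval.\<close>

lemma Z_neg_nontrivial_imp_base_ge:
  assumes "\<beta> > 1" and "x \<in> Z_neg \<beta>" and "x \<noteq> 0"
  shows "\<beta> + 1 \<le> \<beta>\<^sup>2"
proof -
  obtain n y where y: "y \<in> {- \<beta> / (\<beta> + 1) <..< 1 / (\<beta> + 1)}"
    and x: "x = (- \<beta>) ^ n * y" and T: "(T_neg \<beta> ^^ n) y = 0"
    using assms(1,2) Z_neg_iff by blast
  have yI: "y \<in> {- \<beta> / (\<beta> + 1) ..< 1 / (\<beta> + 1)}" using y by auto
  have "(T_neg \<beta> ^^ 0) y \<noteq> 0" using x assms(3) by auto
  then obtain m where m: "(T_neg \<beta> ^^ m) y \<noteq> 0" "(T_neg \<beta> ^^ Suc m) y = 0"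
    using T by (induction n) auto
  define u where "u = (T_neg \<beta> ^^ m) y"
  have eq: "- \<beta> * u = of_int (d_neg \<beta> y (Suc m))"
    using m(2) unfolding T_neg_funpow_Suc u_def by simp
  then have "d_neg \<beta> y (Suc m) \<noteq> 0"
    using m(1) assms(1) by (auto simp: u_def)
  then have "1 \<le> d_neg \<beta> y (Suc m)"
    using d_neg_bounds(1) [OF assms(1) yI, of "Suc m"] by linarith
  then have "1 \<le> \<beta> * - u" using eq by simp
  moreover have "\<beta> * - u \<le> \<beta> * (\<beta> / (\<beta> + 1))"
    using T_neg_funpow_mem [OF assms(1) yI, of m] assms(1)
    by (intro mult_left_mono) (auto simp: u_def)
  ultimately have "1 \<le> \<beta> * (\<beta> / (\<beta> + 1))" by linarith
  then show ?thesis using assms(1) by (simp add: field_simps power2_eq_square)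
qed

section \<open>The conjugation\<close>

lemma is_subfield_rat_adjoin: "is_subfield (rat_adjoin a)"
  unfolding rat_adjoin_def is_subfield_def by auto

lemma mem_rat_adjoin: "a \<in> rat_adjoin a"
  by (auto simp: rat_adjoin_def)

lemma is_subfield_of_nat: "is_subfield F \<Longrightarrow> of_nat n \<in> F"
  by (induction n) (simp_all add: is_subfield_def)

lemma is_subfield_power: "is_subfield F \<Longrightarrow> x \<in> F \<Longrightarrow> x ^ n \<in> F"
  by (induction n) (simp_all add: is_subfield_def)

lemma is_subfield_uminus: "is_subfield F \<Longrightarrow> x \<in> F \<Longrightarrow> - x \<in> F"
  by (simp add: is_subfield_def)

lemma is_subfield_add: "is_subfield F \<Longrightarrow> x \<in> F \<Longrightarrow> y \<in> F \<Longrightarrow> x + y \<in> F"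
  by (simp add: is_subfield_def)

lemma is_subfield_mult: "is_subfield F \<Longrightarrow> x \<in> F \<Longrightarrow> y \<in> F \<Longrightarrow> x * y \<in> F"
  by (simp add: is_subfield_def)

lemma is_subfield_sum: "is_subfield F \<Longrightarrow> (\<And>k. k < n \<Longrightarrow> f k \<in> F) \<Longrightarrow> (\<Sum>k<(n::nat). f k) \<in> F"
  by (induction n) (simp_all add: is_subfield_def)

text \<open>The map is total in type but controlled only on \<open>F\<close>, so the rules below
  carry membership side conditions.\<close>

locale subfield_hom =
  fixes \<sigma> :: "'a::field \<Rightarrow> 'b::field" and F :: "'a set"
  assumes subfield: "is_subfield F"
    and hom_one: "\<sigma> 1 = 1"
    and hom_add: "x \<in> F \<Longrightarrow> y \<in> F \<Longrightarrow> \<sigma> (x + y) = \<sigma> x + \<sigma> y"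
    and hom_mult: "x \<in> F \<Longrightarrow> y \<in> F \<Longrightarrow> \<sigma> (x * y) = \<sigma> x * \<sigma> y"
begin

lemma hom_zero: "\<sigma> 0 = 0"
proof -
  have "0 \<in> F" using subfield by (simp add: is_subfield_def)
  from hom_add [OF this this] have "\<sigma> 0 + 0 = \<sigma> 0 + \<sigma> 0" by simp
  then show ?thesis unfolding add_left_cancel by (rule sym)
qed

lemma hom_uminus: "x \<in> F \<Longrightarrow> \<sigma> (- x) = - \<sigma> x"
  using hom_add [of x "- x"] subfield hom_zero
  by (simp add: is_subfield_def eq_neg_iff_add_eq_0 add.commute)

lemma hom_of_nat: "\<sigma> (of_nat n) = of_nat n"
  using subfield is_subfield_of_nat [OF subfield]
  by (induction n) (simp_all add: hom_zero hom_one hom_add is_subfield_def)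

lemma hom_power: "x \<in> F \<Longrightarrow> \<sigma> (x ^ n) = \<sigma> x ^ n"
  by (induction n) (simp_all add: hom_one hom_mult is_subfield_power [OF subfield])

lemma hom_sum: "(\<And>k. k < n \<Longrightarrow> f k \<in> F) \<Longrightarrow> \<sigma> (\<Sum>k<(n::nat). f k) = (\<Sum>k<n. \<sigma> (f k))"
  by (induction n) (simp_all add: hom_zero hom_add is_subfield_sum [OF subfield])

end

section \<open>Conjugates of (-\<beta>)-integers and bounds on denominators\<close>

locale neg_base_conjugation = subfield_hom \<sigma> F
  for \<sigma> :: "real \<Rightarrow> complex" and F :: "real set" +
  fixes \<beta> :: real
  assumes base_gt_1: "\<beta> > 1"
    and base_mem: "\<beta> \<in> F"
    and conj_nonzero: "\<sigma> \<beta> \<noteq> 0"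
    and conj_lt_1: "cmod (\<sigma> \<beta>) < 1"
begin

text \<open>Both claims are read off the digit sum: it is a polynomial in -\<beta> with digits in
  [0, \<beta>], so its conjugate is dominated by a geometric series. Hence the supremum
  \<open>H\<close> is finite.\<close>

lemma
  assumes "x \<in> Z_neg \<beta>"
  shows Z_neg_mem: "x \<in> F"
    and Z_neg_conj_bound: "cmod (\<sigma> x) \<le> \<beta> / (1 - cmod (\<sigma> \<beta>))"
proof -
  obtain n and a :: "nat \<Rightarrow> int" where a: "\<And>k. 0 \<le> a k \<and> of_int (a k) \<le> \<beta>"
    and x: "x = (\<Sum>k<n. of_int (a k) * (- \<beta>) ^ k)"
    using Z_neg_digit_sum [OF base_gt_1 assms] by blast
  \<comment> \<open>Digits are nonnegative, so they can be written as naturals, which the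
    homomorphism fixes.\<close>
  have "of_int (a k) = (of_nat (nat (a k)) :: real)" for k
    using a by simp
  then have x: "x = (\<Sum>k<n. of_nat (nat (a k)) * (- \<beta>) ^ k)"
    using x by simp
  have pow: "(- \<beta>) ^ k \<in> F" for k
    by (intro is_subfield_power is_subfield_uminus subfield base_mem)
  have mem: "of_nat (nat (a k)) * (- \<beta>) ^ k \<in> F" for k
    by (intro is_subfield_mult is_subfield_of_nat subfield pow)
  show "x \<in> F"
    unfolding x by (intro is_subfield_sum subfield mem)
  have "\<sigma> x = (\<Sum>k<n. of_nat (nat (a k)) * (- \<sigma> \<beta>) ^ k)"
    unfolding x
    by (simp add: hom_sum mem hom_mult hom_power hom_uminus hom_of_nat pow
        is_subfield_of_nat [OF subfield] is_subfield_uminus [OF subfield] base_mem)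
  then have "cmod (\<sigma> x) \<le> (\<Sum>k<n. cmod (of_nat (nat (a k)) * (- \<sigma> \<beta>) ^ k))"
    by (simp only: norm_sum)
  also have "\<dots> \<le> (\<Sum>k<n. \<beta> * cmod (\<sigma> \<beta>) ^ k)"
    using a by (intro sum_mono) (simp add: norm_mult norm_power mult_right_mono)
  also have "\<dots> = \<beta> * (\<Sum>k<n. cmod (\<sigma> \<beta>) ^ k)"
    by (simp add: sum_distrib_left)
  also have "(\<Sum>k<n. cmod (\<sigma> \<beta>) ^ k) = (1 - cmod (\<sigma> \<beta>) ^ n) / (1 - cmod (\<sigma> \<beta>))"
    using conj_lt_1 by (subst sum_gp_strict) auto
  also have "\<beta> * \<dots> \<le> \<beta> * (1 / (1 - cmod (\<sigma> \<beta>)))"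
    using base_gt_1 conj_lt_1 by (intro mult_left_mono divide_right_mono) auto
  finally show "cmod (\<sigma> x) \<le> \<beta> / (1 - cmod (\<sigma> \<beta>))" by simp
qed

lemma bdd_above_Z_neg: "bdd_above ((\<lambda>z. cmod (\<sigma> z)) ` Z_neg \<beta>)"
  by (rule bdd_aboveI2) (rule Z_neg_conj_bound)

text \<open>Here \<open>m\<close> is an exponent too small to clear the denominator. The least
  sufficient \<open>l\<close> exceeds it because integers are closed under multiplication by the
  base; if the numerator were a base multiple, \<open>l - 1\<close> would suffice.\<close>

lemma Fin_neg_numerator:
  assumes "u \<in> Fin_neg \<beta>" and "u \<in> F"
    and "(- \<beta>) ^ m * u \<notin> Z_neg \<beta>"
  shows "\<exists>l>m. \<exists>w \<in> Z_neg \<beta> - (\<lambda>z. - \<beta> * z) ` Z_neg \<beta>. cmod (\<sigma> w) = cmod (\<sigma> \<beta>) ^ l * cmod (\<sigma> u)"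
proof -
  define l where "l = (LEAST l. (- \<beta>) ^ l * u \<in> Z_neg \<beta>)"
  have l: "(- \<beta>) ^ l * u \<in> Z_neg \<beta>"
    unfolding l_def
    by (rule LeastI_ex [OF Fin_neg_imp_mult_base_power_mem_Z_neg [OF base_gt_1 assms(1)]])
  have "l > m"
  proof (rule ccontr)
    assume "\<not> l > m"
    then have "(- \<beta>) ^ m * u = (- \<beta>) ^ (m - l) * ((- \<beta>) ^ l * u)"
      by (simp flip: mult.assoc power_add)
    then show False using Z_neg_mult_base_power [OF base_gt_1 l] assms(3) by metis
  qed
  moreover have "(- \<beta>) ^ l * u \<notin> (\<lambda>z. - \<beta> * z) ` Z_neg \<beta>"
  proof
    assume "(- \<beta>) ^ l * u \<in> (\<lambda>z. - \<beta> * z) ` Z_neg \<beta>"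
    then obtain z where z: "z \<in> Z_neg \<beta>" "(- \<beta>) ^ l * u = - \<beta> * z" by blast
    obtain k where k: "l = Suc k" using \<open>l > m\<close> by (cases l) auto
    have "(- \<beta>) ^ k * u = z" using z(2) base_gt_1 by (simp add: k)
    then have "l \<le> k" unfolding l_def using z(1) by (intro Least_le) simp
    then show False using k by simp
  qed
  moreover have "cmod (\<sigma> ((- \<beta>) ^ l * u)) = cmod (\<sigma> \<beta>) ^ l * cmod (\<sigma> u)"
    using assms(2) base_mem subfield
    by (simp add: hom_mult hom_power hom_uminus norm_mult norm_power is_subfield_power
        is_subfield_uminus)
  ultimately show ?thesis using l by blast
qed

text \<open>In the application \<open>f\<close> is addition or multiplication, and \<open>B\<close> is
  \<open>2H\<close> or \<open>H\<^sup>2\<close>.\<close>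

lemma Least_denominator_bound:
  fixes f :: "real \<Rightarrow> real \<Rightarrow> real" and B H K :: real
  defines "S \<equiv> {l. \<forall>x\<in>Z_neg \<beta>. \<forall>y\<in>Z_neg \<beta>.
     f x y \<in> Fin_neg \<beta> \<longrightarrow> f x y \<in> (\<lambda>z. z / (- \<beta>) ^ l) ` Z_neg \<beta>}"
  assumes f_mem: "\<And>x y. x \<in> F \<Longrightarrow> y \<in> F \<Longrightarrow> f x y \<in> F"
    and f_le: "\<And>x y. x \<in> Z_neg \<beta> \<Longrightarrow> y \<in> Z_neg \<beta> \<Longrightarrow> cmod (\<sigma> (f x y)) \<le> B"
    and f_less: "\<And>x y. \<not> (\<exists>z\<in>Z_neg \<beta>. cmod (\<sigma> z) = H) \<Longrightarrow>
      x \<in> Z_neg \<beta> \<Longrightarrow> y \<in> Z_neg \<beta> \<Longrightarrow> cmod (\<sigma> (f x y)) < B"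
    and K_le: "\<And>z. z \<in> Z_neg \<beta> - (\<lambda>z. - \<beta> * z) ` Z_neg \<beta> \<Longrightarrow> K \<le> cmod (\<sigma> z)"
    and K_pos: "K > 0"
    and K_le_B: "K \<le> B"
    and K_less_B: "\<not> (\<exists>z\<in>Z_neg \<beta>. cmod (\<sigma> z) = H) \<or>
      \<not> (\<exists>z\<in>Z_neg \<beta> - (\<lambda>z. - \<beta> * z) ` Z_neg \<beta>. cmod (\<sigma> z) = K) \<Longrightarrow> K < B"
  shows "S \<noteq> {}"
    and "1 / cmod (\<sigma> \<beta>) ^ (LEAST l. l \<in> S) \<le> B / K"
    and "\<not> (\<exists>z\<in>Z_neg \<beta>. cmod (\<sigma> z) = H) \<or>
      \<not> (\<exists>z\<in>Z_neg \<beta> - (\<lambda>z. - \<beta> * z) ` Z_neg \<beta>. cmod (\<sigma> z) = K) \<Longrightarrow>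
      1 / cmod (\<sigma> \<beta>) ^ (LEAST l. l \<in> S) < B / K"
proof -
  define c where "c = cmod (\<sigma> \<beta>)"
  have c: "0 < c" "c < 1" using conj_nonzero conj_lt_1 by (simp_all add: c_def)
  \<comment> \<open>Every failing exponent \<open>m\<close> needs a power of at least
    \<open>m + 1\<close>, which costs that many factors \<open>c\<close>.\<close>
  have core: "K \<le> c ^ Suc m * B"
    "\<not> (\<exists>z\<in>Z_neg \<beta>. cmod (\<sigma> z) = H) \<or>
      \<not> (\<exists>z\<in>Z_neg \<beta> - (\<lambda>z. - \<beta> * z) ` Z_neg \<beta>. cmod (\<sigma> z) = K) \<Longrightarrow> K < c ^ Suc m * B"
    if "m \<notin> S" for m
  proof -
    from that obtain x y where xy: "x \<in> Z_neg \<beta>" "y \<in> Z_neg \<beta>" and fin: "f x y \<in> Fin_neg \<beta>"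
      and notin: "f x y \<notin> (\<lambda>z. z / (- \<beta>) ^ m) ` Z_neg \<beta>"
      unfolding S_def by blast
    have eq: "f x y = (- \<beta>) ^ m * f x y / (- \<beta>) ^ m"
      using base_gt_1 by simp
    have "(- \<beta>) ^ m * f x y \<notin> Z_neg \<beta>"
    proof
      assume "(- \<beta>) ^ m * f x y \<in> Z_neg \<beta>"
      then show False using notin eq by (metis image_eqI)
    qed
    then obtain l w where l: "l > m" and w: "w \<in> Z_neg \<beta> - (\<lambda>z. - \<beta> * z) ` Z_neg \<beta>"
      and nw: "cmod (\<sigma> w) = c ^ l * cmod (\<sigma> (f x y))"
      using Fin_neg_numerator [OF fin f_mem [OF Z_neg_mem [OF xy(1)] Z_neg_mem [OF xy(2)]]]
      unfolding c_def by blast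
    have "0 \<le> B" using K_pos K_le_B by simp
    moreover have "c ^ l \<le> c ^ Suc m" using l c by (intro power_decreasing) auto
    ultimately have cl: "c ^ l * B \<le> c ^ Suc m * B" by (rule mult_right_mono [rotated])
    have wB: "c ^ l * cmod (\<sigma> (f x y)) \<le> c ^ l * B"
      using c f_le [OF xy] by (intro mult_left_mono) auto
    show "K \<le> c ^ Suc m * B" using K_le [OF w] nw wB cl by linarith
    assume "\<not> (\<exists>z\<in>Z_neg \<beta>. cmod (\<sigma> z) = H) \<or>
      \<not> (\<exists>z\<in>Z_neg \<beta> - (\<lambda>z. - \<beta> * z) ` Z_neg \<beta>. cmod (\<sigma> z) = K)"
    \<comment> \<open>An unattained \<open>H\<close> makes the bound on the conjugate of
      \<open>f x y\<close> strict; an unattained \<open>K\<close> makes K < |\<sigma> w|.\<close>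
    then show "K < c ^ Suc m * B"
    proof
      assume "\<not> (\<exists>z\<in>Z_neg \<beta>. cmod (\<sigma> z) = H)"
      then have "c ^ l * cmod (\<sigma> (f x y)) < c ^ l * B"
        using c f_less [OF _ xy] by (intro mult_strict_left_mono) auto
      then show ?thesis using K_le [OF w] nw cl by linarith
    next
      assume "\<not> (\<exists>z\<in>Z_neg \<beta> - (\<lambda>z. - \<beta> * z) ` Z_neg \<beta>. cmod (\<sigma> z) = K)"
      then have "K \<noteq> cmod (\<sigma> w)" using w by blast
      then show ?thesis using K_le [OF w] nw wB cl by linarith
    qed
  qed
  have "B > 0" using K_pos K_le_B by simp
  \<comment> \<open>If every exponent failed, \<open>core\<close> would hold for all
    \<open>m\<close>, but its right side tends to 0 while \<open>K\<close> is positive. So the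
    \<open>LEAST\<close> is a true minimum.\<close>
  show "S \<noteq> {}"
  proof
    assume S: "S = {}"
    obtain m where m: "c ^ m < K / B"
      using real_arch_pow_inv [of "K / B" c] c \<open>B > 0\<close> K_pos by auto
    have "c ^ Suc m \<le> c ^ m" using c by (intro power_decreasing) auto
    then have "c ^ Suc m < K / B" using m by linarith
    then have "c ^ Suc m * B < K" using \<open>B > 0\<close> by (simp add: field_simps)
    then show False using core(1) [of m] S by simp
  qed
  define L where "L = (LEAST l. l \<in> S)"
  \<comment> \<open>For positive \<open>L\<close> the predecessor fails by minimality, and
    \<open>core\<close> at it gives exactly K \<le> c^L B.\<close>
  have pred: "m \<notin> S" if "L = Suc m" for m
    using not_less_Least [of m "\<lambda>l. l \<in> S"] that unfolding L_def by simp
  have "1 / c ^ L \<le> B / K"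
  proof (cases L)
    case 0
    \<comment> \<open>With exponent 0 the claim reads 1 \<le> B/K.\<close>
    then show ?thesis using K_le_B K_pos by simp
  next
    case (Suc m)
    then show ?thesis using core(1) [OF pred] c K_pos by (simp add: field_simps)
  qed
  then show "1 / cmod (\<sigma> \<beta>) ^ (LEAST l. l \<in> S) \<le> B / K" by (simp add: c_def L_def)
  assume na: "\<not> (\<exists>z\<in>Z_neg \<beta>. cmod (\<sigma> z) = H) \<or>
      \<not> (\<exists>z\<in>Z_neg \<beta> - (\<lambda>z. - \<beta> * z) ` Z_neg \<beta>. cmod (\<sigma> z) = K)"
  have "1 / c ^ L < B / K"
  proof (cases L)
    case 0
    then show ?thesis using K_less_B [OF na] K_pos by simp
  next
    case (Suc m)
    then show ?thesis using core(2) [OF pred na] c K_pos by (simp add: field_simps)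
  qed
  then show "1 / cmod (\<sigma> \<beta>) ^ (LEAST l. l \<in> S) < B / K" by (simp add: c_def L_def)
qed

end

text \<open>The first three conjuncts ensure that \<open>H\<close> is a genuine supremum and both
  \<open>LEAST\<close> values are genuine minima. The nonemptiness assumption gives the infimum
  meaning; it excludes the case where 0 is the only (-\<beta>)-integer.\<close>

theorem theorem7:
  fixes \<beta> :: real and \<beta>' :: complex and \<sigma> :: "real \<Rightarrow> complex" and H K :: real
  assumes "\<beta> > 1" and "algebraic \<beta>"
    and "is_conjugate \<beta> \<beta>'" and "cmod \<beta>' < 1"
    and "field_iso_on \<sigma> (rat_adjoin \<beta>) (rat_adjoin \<beta>')" and "\<sigma> \<beta> = \<beta>'"
    and "H = (SUP z\<in>Z_neg \<beta>. cmod (\<sigma> z))"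
    and "Z_neg \<beta> - (\<lambda>z. - \<beta> * z) ` Z_neg \<beta> \<noteq> {}"
    and "K = (INF z\<in>Z_neg \<beta> - (\<lambda>z. - \<beta> * z) ` Z_neg \<beta>. cmod (\<sigma> z))"
    and "K > 0"
  shows "bdd_above ((\<lambda>z. cmod (\<sigma> z)) ` Z_neg \<beta>) \<and>
    L_plus_set \<beta> \<noteq> {} \<and> L_times_set \<beta> \<noteq> {} \<and>
    1 / cmod \<beta>' ^ L_plus \<beta> \<le> 2 * H / K \<and>
    1 / cmod \<beta>' ^ L_times \<beta> \<le> H\<^sup>2 / K \<and>
    ((\<not> (\<exists>z\<in>Z_neg \<beta>. cmod (\<sigma> z) = H) \<or>
      \<not> (\<exists>z\<in>Z_neg \<beta> - (\<lambda>z. - \<beta> * z) ` Z_neg \<beta>. cmod (\<sigma> z) = K)) \<longrightarrow>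
      1 / cmod \<beta>' ^ L_plus \<beta> < 2 * H / K \<and>
      1 / cmod \<beta>' ^ L_times \<beta> < H\<^sup>2 / K)"
proof -
  let ?na = "\<not> (\<exists>z\<in>Z_neg \<beta>. cmod (\<sigma> z) = H) \<or>
      \<not> (\<exists>z\<in>Z_neg \<beta> - (\<lambda>z. - \<beta> * z) ` Z_neg \<beta>. cmod (\<sigma> z) = K)"
  interpret subfield_hom \<sigma> "rat_adjoin \<beta>"
    using assms(5) is_subfield_rat_adjoin by unfold_locales (auto simp: field_iso_on_def)
  \<comment> \<open>Injectivity on Q(\<beta>) keeps the conjugate away from 0, so its powers may be
    divided by.\<close>
  have "\<sigma> \<beta> \<noteq> \<sigma> 0"
  proof
    assume "\<sigma> \<beta> = \<sigma> 0"
    then have "\<beta> = 0"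
      using assms(5) mem_rat_adjoin [of \<beta>] subfield
      unfolding field_iso_on_def bij_betw_def is_subfield_def by (meson inj_onD)
    then show False using assms(1) by simp
  qed
  then interpret neg_base_conjugation \<sigma> "rat_adjoin \<beta>" \<beta>
    using assms(1,4,6) mem_rat_adjoin by unfold_locales (auto simp: hom_zero)
  have H_ge: "cmod (\<sigma> z) \<le> H" if "z \<in> Z_neg \<beta>" for z
    unfolding assms(7) using that bdd_above_Z_neg by (rule cSUP_upper)
  have K_le: "K \<le> cmod (\<sigma> z)" if "z \<in> Z_neg \<beta> - (\<lambda>z. - \<beta> * z) ` Z_neg \<beta>" for z
    unfolding assms(9) using that by (intro cINF_lower bdd_belowI2 [of _ 0]) auto
  obtain w where w: "w \<in> Z_neg \<beta> - (\<lambda>z. - \<beta> * z) ` Z_neg \<beta>" using assms(8) by blast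
  then have KwH: "K \<le> cmod (\<sigma> w)" "cmod (\<sigma> w) \<le> H" using K_le H_ge by blast+
  \<comment> \<open>Positivity of \<open>K\<close> makes \<open>w\<close> a nonzero integer; this
    forces the inequality on \<beta> under which 1 is an integer.\<close>
  have "\<sigma> w \<noteq> 0" using KwH(1) assms(10) by auto
  then have "w \<noteq> 0" using hom_zero by auto
  then have "1 \<in> Z_neg \<beta>"
    using w assms(1) one_mem_Z_neg Z_neg_nontrivial_imp_base_ge by blast
  then have H1: "1 \<le> H" using H_ge [of 1] by (simp add: hom_one)
  have KH: "K \<le> H" using KwH by linarith
  \<comment> \<open>Since K \<le> |\<sigma> w| \<le> H, equality K = H would make \<open>w\<close>
    attain both extrema.\<close>
  have na: "K < H" if "?na"
  proof -
    have "cmod (\<sigma> w) \<noteq> H \<or> cmod (\<sigma> w) \<noteq> K" using that w by blast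
    then show ?thesis using KwH by linarith
  qed
  have H_sq: "H \<le> H\<^sup>2" using H1 by (simp add: power2_eq_square)
  have H_less: "cmod (\<sigma> z) < H" if "\<not> (\<exists>z\<in>Z_neg \<beta>. cmod (\<sigma> z) = H)" "z \<in> Z_neg \<beta>" for z
    using H_ge [OF that(2)] that by fastforce
  have norm_add: "cmod (\<sigma> (x + y)) \<le> cmod (\<sigma> x) + cmod (\<sigma> y)"
    if "x \<in> Z_neg \<beta>" "y \<in> Z_neg \<beta>" for x y
    using that by (simp add: hom_add Z_neg_mem norm_triangle_ineq)
  have norm_mul: "cmod (\<sigma> (x * y)) = cmod (\<sigma> x) * cmod (\<sigma> y)"
    if "x \<in> Z_neg \<beta>" "y \<in> Z_neg \<beta>" for x y
    using that by (simp add: hom_mult Z_neg_mem norm_mult)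
  have add_le: "cmod (\<sigma> (x + y)) \<le> 2 * H" if "x \<in> Z_neg \<beta>" "y \<in> Z_neg \<beta>" for x y
    using norm_add [OF that] H_ge [OF that(1)] H_ge [OF that(2)] by linarith
  have add_less: "cmod (\<sigma> (x + y)) < 2 * H"
    if "\<not> (\<exists>z\<in>Z_neg \<beta>. cmod (\<sigma> z) = H)" "x \<in> Z_neg \<beta>" "y \<in> Z_neg \<beta>" for x y
    using norm_add [OF that(2,3)] H_less [OF that(1,2)] H_less [OF that(1,3)] by linarith
  have mul_le: "cmod (\<sigma> (x * y)) \<le> H\<^sup>2" if "x \<in> Z_neg \<beta>" "y \<in> Z_neg \<beta>" for x y
    unfolding norm_mul [OF that] power2_eq_square
    using H_ge [OF that(1)] H_ge [OF that(2)] H1 by (intro mult_mono) auto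
  have mul_less: "cmod (\<sigma> (x * y)) < H\<^sup>2"
    if "\<not> (\<exists>z\<in>Z_neg \<beta>. cmod (\<sigma> z) = H)" "x \<in> Z_neg \<beta>" "y \<in> Z_neg \<beta>" for x y
    unfolding norm_mul [OF that(2,3)] power2_eq_square
    using H_less [OF that(1,2)] H_less [OF that(1,3)] by (intro mult_strict_mono') auto
  have K2H: "K \<le> 2 * H" "?na \<Longrightarrow> K < 2 * H" and KHsq: "K \<le> H\<^sup>2" "?na \<Longrightarrow> K < H\<^sup>2"
    using KH na H1 H_sq by linarith+
  \<comment> \<open>The set \<open>S\<close> for addition is literally \<open>L_plus_set\<close>, so
    folding turns the generic bound into one on \<open>L_plus\<close>; the product is handled
    likewise.\<close>
  note plus = Least_denominator_bound [of "(+)" "2 * H" H K, OF is_subfield_add [OF subfield]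
      add_le add_less K_le assms(10) K2H, folded L_plus_set_def, folded L_plus_def]
  note times = Least_denominator_bound [of "(*)" "H\<^sup>2" H K, OF is_subfield_mult [OF subfield]
      mul_le mul_less K_le assms(10) KHsq, folded L_times_set_def, folded L_times_def]
  show ?thesis
    unfolding assms(6) [symmetric]
    by (intro conjI impI bdd_above_Z_neg plus times)
qed

end
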